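(* Let $r\in(0,\infty)$, $\nu>-1$, and let $\lambda_\nu$ be the normalized modified Dini function. For real constants $\alpha,\beta$, the Redheffer-type inequality $$\left(\frac{r^2+x^2}{r^2-x^2}\right)^{\alpha}\le\lambda_\nu(x)\le\left(\frac{r^2+x^2}{r^2-x^2}\right)^{\beta}$$ holds for all $|x|<r$ if and only if $\alpha\le0$ and $\beta\ge\frac{3r^2}{8(\nu+1)}$.
   Context: $I_\nu$ is the modified Bessel function of the first kind. The modified Dini function is $\xi_\nu(z)=(1-\nu)I_\nu(z)+zI_\nu'(z)=I_\nu(z)+zI_{\nu+1}(z)$, and its normalization is $\lambda_\nu(x)=2^\nu\Gamma(\nu+1)x^{-\nu}\xi_\nu(x)$, an even entire function with $\lambda_\nu(0)=1$. It satisfies $\lambda_\nu(x)=\prod_{n\ge1}\left(1+\frac{x^2}{\alpha_{\nu,n}^2}\right)$, where $\alpha_{\nu,n}$ is the $n$th positive zero of $d_\nu(z)=(1-\nu)J_\nu(z)+zJ_\nu'(z)$ and $J_\nu$ is the Bessel function of the first kind. *)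

theory Defs
  imports "HOL-Analysis.Analysis"
begin

(* The functions are given on the positive half-line, where x powr s is the usual real power.
   rGamma is the reciprocal Gamma function, so the terms with Gamma at a pole vanish. *)
definition modified_bessel_I :: "real \<Rightarrow> real \<Rightarrow> real" where
  "modified_bessel_I \<nu> x =
     (\<Sum>n. rGamma (real n + \<nu> + 1) / fact n * (x / 2) powr (2 * real n + \<nu>))"

definition modified_dini :: "real \<Rightarrow> real \<Rightarrow> real" where
  "modified_dini \<nu> x = (1 - \<nu>) * modified_bessel_I \<nu> x + x * deriv (modified_bessel_I \<nu>) x"

(* x powr (-\<nu>) * modified_dini \<nu> x is meaningful for x > 0 only; the normalized function is its
   even entire continuation, whose value at 0 is 1.  The lemma
   modified_dini_normalized_sums below confirms that this is what the case distinction gives. *)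
definition modified_dini_normalized :: "real \<Rightarrow> real \<Rightarrow> real" where
  "modified_dini_normalized \<nu> x =
     (if x = 0 then 1
      else 2 powr \<nu> * Gamma (\<nu> + 1) * \<bar>x\<bar> powr (-\<nu>) * modified_dini \<nu> \<bar>x\<bar>)"

definition bessel_coeff :: "real \<Rightarrow> nat \<Rightarrow> real" where
  "bessel_coeff \<nu> n = rGamma (real n + \<nu> + 1) / fact n"

lemma bessel_coeff_Suc: "real (Suc n) * bessel_coeff \<nu> (Suc n) = bessel_coeff (\<nu> + 1) n"
proof -
  have "real (Suc n) * (g / (real (Suc n) * f)) = g / f" for g f :: real by simp
  moreover have "real (Suc n) + \<nu> + 1 = real n + (\<nu> + 1) + 1" by simp
  ultimately show ?thesis unfolding bessel_coeff_def fact_Suc by (simp only: of_nat_mult)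
qed

lemma rGamma_pochhammer:
  fixes \<nu> :: real
  assumes "\<nu> > -1"
  shows "rGamma (real n + \<nu> + 1) = rGamma (\<nu> + 1) / pochhammer (\<nu> + 1) n"
proof -
  have "pochhammer (\<nu> + 1) n > 0" using assms by (intro pochhammer_pos) simp
  then show ?thesis using pochhammer_rGamma[of "\<nu> + 1" n] by (simp add: field_simps)
qed

lemma summable_bessel_coeff:
  assumes "\<nu> > -1"
  shows "summable (\<lambda>n. bessel_coeff \<nu> n * t ^ n)"
proof (rule summable_comparison_test')
  define C where "C = \<bar>rGamma (\<nu> + 1)\<bar>"
  define q where "q = \<bar>t\<bar> / (\<nu> + 1)"
  show "summable (\<lambda>n. C * (inverse (fact n) * q ^ n))"
    by (intro summable_mult summable_exp)
  fix n :: nat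
  have "(\<nu> + 1) ^ n \<le> pochhammer (\<nu> + 1) n"
  proof (induction n)
    case (Suc n)
    have "(\<nu> + 1) ^ n * (\<nu> + 1) \<le> pochhammer (\<nu> + 1) n * (\<nu> + 1 + real n)"
      using assms Suc
      by (intro mult_mono) (auto intro!: pochhammer_nonneg)
    then show ?case by (simp add: pochhammer_Suc algebra_simps)
  qed simp
  moreover have p: "(\<nu> + 1) ^ n > 0" using assms by simp
  ultimately have "C * (\<bar>t\<bar> ^ n / fact n) / pochhammer (\<nu> + 1) n \<le> C * (\<bar>t\<bar> ^ n / fact n) / (\<nu> + 1) ^ n"
    by (intro divide_left_mono) (auto simp: C_def)
  moreover have "pochhammer (\<nu> + 1) n > 0"
    using assms by (intro pochhammer_pos) simp
  ultimately show "norm (bessel_coeff \<nu> n * t ^ n) \<le> C * (inverse (fact n) * q ^ n)"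
    using assms unfolding bessel_coeff_def rGamma_pochhammer[OF assms]
    by (simp add: C_def q_def abs_mult power_abs power_divide field_simps)
qed

lemma modified_bessel_I_eq:
  assumes "x > 0" "\<nu> > -1"
  shows "modified_bessel_I \<nu> x = (x / 2) powr \<nu> * (\<Sum>n. bessel_coeff \<nu> n * ((x / 2)\<^sup>2) ^ n)"
proof -
  have "(x / 2) powr (2 * real n + \<nu>) = (x / 2) powr \<nu> * ((x / 2)\<^sup>2) ^ n" for n
  proof -
    have "(x / 2) powr (2 * real n) = (x / 2) powr (real (2 * n))" by simp
    also have "\<dots> = (x / 2) ^ (2 * n)" using assms by (subst powr_realpow) auto
    finally show ?thesis by (simp add: powr_add power_mult)
  qed
  then have "modified_bessel_I \<nu> x =
      (\<Sum>n. (x / 2) powr \<nu> * (bessel_coeff \<nu> n * ((x / 2)\<^sup>2) ^ n))"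
    by (simp add: modified_bessel_I_def bessel_coeff_def mult_ac)
  also have "\<dots> = (x / 2) powr \<nu> * (\<Sum>n. bessel_coeff \<nu> n * ((x / 2)\<^sup>2) ^ n)"
    by (intro suminf_mult summable_bessel_coeff assms)
  finally show ?thesis .
qed

lemma modified_bessel_I_has_derivative:
  assumes "x > 0" "\<nu> > -1"
  shows "(modified_bessel_I \<nu> has_real_derivative
            \<nu> / x * modified_bessel_I \<nu> x + modified_bessel_I (\<nu> + 1) x) (at x)"
proof -
  define F where "F = (\<lambda>t. \<Sum>n. bessel_coeff \<nu> n * t ^ n)"
  define G where "G = (\<lambda>t. \<Sum>n. bessel_coeff (\<nu> + 1) n * t ^ n)"
  have d: "(F has_real_derivative G t) (at t)" for t
  proof -
    have "(F has_real_derivative (\<Sum>n. diffs (bessel_coeff \<nu>) n * t ^ n)) (at t)"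
      unfolding F_def by (rule termdiffs_strong_converges_everywhere) (rule summable_bessel_coeff[OF assms(2)])
    then show ?thesis by (simp only: diffs_def of_nat_Suc[symmetric] bessel_coeff_Suc G_def)
  qed
  note [derivative_intros] = DERIV_chain2[OF d]
  have "((\<lambda>x. (x / 2) powr \<nu> * F ((x / 2)\<^sup>2)) has_real_derivative
      \<nu> / x * ((x / 2) powr \<nu> * F ((x / 2)\<^sup>2)) + (x / 2) powr (\<nu> + 1) * G ((x / 2)\<^sup>2)) (at x)"
    using assms by (auto intro!: derivative_eq_intros simp: powr_add powr_diff field_simps power2_eq_square)
  moreover have "\<nu> / x * ((x / 2) powr \<nu> * F ((x / 2)\<^sup>2)) + (x / 2) powr (\<nu> + 1) * G ((x / 2)\<^sup>2) =
      \<nu> / x * modified_bessel_I \<nu> x + modified_bessel_I (\<nu> + 1) x"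
    using assms by (simp add: modified_bessel_I_eq F_def G_def)
  ultimately have "((\<lambda>x. (x / 2) powr \<nu> * F ((x / 2)\<^sup>2)) has_real_derivative
      \<nu> / x * modified_bessel_I \<nu> x + modified_bessel_I (\<nu> + 1) x) (at x)" by simp
  then show ?thesis
    by (rule has_field_derivative_transform_within_open[of _ _ _ "{0<..}"])
       (use assms in \<open>auto simp: modified_bessel_I_eq F_def\<close>)
qed

lemma modified_dini_eq:
  assumes "x > 0" "\<nu> > -1"
  shows "modified_dini \<nu> x = modified_bessel_I \<nu> x + x * modified_bessel_I (\<nu> + 1) x"
  using DERIV_imp_deriv[OF modified_bessel_I_has_derivative[OF assms]] assms
  by (simp add: modified_dini_def field_simps)

lemma modified_dini_normalized_sums:
  assumes "\<nu> > -1"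
  shows "(\<lambda>n. (2 * real n + 1) / (fact n * pochhammer (\<nu> + 1) n) * (x / 2) ^ (2 * n))
           sums modified_dini_normalized \<nu> x"
proof (cases "x = 0")
  case True
  have "(\<lambda>n. if n = 0 then 1 else 0 :: real) sums 1" by (rule sums_single[of 0 "\<lambda>_. 1"])
  also have "(\<lambda>n. if n = 0 then 1 else 0 :: real) =
      (\<lambda>n. (2 * real n + 1) / (fact n * pochhammer (\<nu> + 1) n) * (x / 2) ^ (2 * n))"
    using True by (auto simp: fun_eq_iff)
  finally show ?thesis using True by (simp add: modified_dini_normalized_def)
next
  case False
  define y t where "y = \<bar>x\<bar>" and "t = (x / 2)\<^sup>2"
  have y: "y > 0" and t: "(y / 2)\<^sup>2 = t" using False by (auto simp: y_def t_def power_divide)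
  have nu1: "\<nu> + 1 > -1" using assms by simp
  have F: "(\<lambda>n. bessel_coeff \<nu> n * t ^ n) sums (\<Sum>n. bessel_coeff \<nu> n * t ^ n)"
    by (rule summable_sums[OF summable_bessel_coeff[OF assms]])
  have "(\<lambda>n. t * (bessel_coeff (\<nu> + 1) n * t ^ n)) sums (t * (\<Sum>n. bessel_coeff (\<nu> + 1) n * t ^ n))"
    by (rule sums_mult[OF summable_sums[OF summable_bessel_coeff[OF nu1]]])
  also have "(\<lambda>n. t * (bessel_coeff (\<nu> + 1) n * t ^ n)) =
      (\<lambda>n. real (Suc n) * bessel_coeff \<nu> (Suc n) * t ^ Suc n)"
    by (simp only: bessel_coeff_Suc power_Suc mult_ac)
  finally have G: "(\<lambda>n. real n * bessel_coeff \<nu> n * t ^ n) sums (t * (\<Sum>n. bessel_coeff (\<nu> + 1) n * t ^ n))"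
    by (subst (asm) sums_Suc_iff) simp
  have "modified_dini \<nu> y =
      (y / 2) powr \<nu> * ((\<Sum>n. bessel_coeff \<nu> n * t ^ n) + 2 * (t * (\<Sum>n. bessel_coeff (\<nu> + 1) n * t ^ n)))"
    using y assms by (simp add: modified_dini_eq modified_bessel_I_eq t powr_add algebra_simps)
       (simp add: t[symmetric] power2_eq_square)
  moreover have "2 powr \<nu> * y powr (-\<nu>) * (y / 2) powr \<nu> = 1"
    using y by (simp add: powr_divide powr_minus field_simps)
  ultimately have "modified_dini_normalized \<nu> x = Gamma (\<nu> + 1) *
      ((\<Sum>n. bessel_coeff \<nu> n * t ^ n) + 2 * (t * (\<Sum>n. bessel_coeff (\<nu> + 1) n * t ^ n)))"
    using False by (simp add: modified_dini_normalized_def y_def[symmetric] mult_ac)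
  moreover have "(\<lambda>n. Gamma (\<nu> + 1) * (bessel_coeff \<nu> n * t ^ n + 2 * (real n * bessel_coeff \<nu> n * t ^ n)))
      sums (Gamma (\<nu> + 1) *
      ((\<Sum>n. bessel_coeff \<nu> n * t ^ n) + 2 * (t * (\<Sum>n. bessel_coeff (\<nu> + 1) n * t ^ n))))"
    by (intro sums_mult sums_add F G)
  moreover have "Gamma (\<nu> + 1) * (bessel_coeff \<nu> n * t ^ n + 2 * (real n * bessel_coeff \<nu> n * t ^ n)) =
      (2 * real n + 1) / (fact n * pochhammer (\<nu> + 1) n) * (x / 2) ^ (2 * n)" for n
  proof -
    have g: "Gamma (\<nu> + 1) > 0" using assms by (intro Gamma_real_pos) simp
    have "bessel_coeff \<nu> n = inverse (Gamma (\<nu> + 1)) / (fact n * pochhammer (\<nu> + 1) n)"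
      unfolding bessel_coeff_def rGamma_pochhammer[OF assms]
      by (simp add: rGamma_inverse_Gamma mult.commute)
    then have c: "Gamma (\<nu> + 1) * bessel_coeff \<nu> n = 1 / (fact n * pochhammer (\<nu> + 1) n)"
      using g by simp
    have "Gamma (\<nu> + 1) * (bessel_coeff \<nu> n * t ^ n + 2 * (real n * bessel_coeff \<nu> n * t ^ n)) =
        Gamma (\<nu> + 1) * bessel_coeff \<nu> n * ((2 * real n + 1) * t ^ n)"
      by (simp add: algebra_simps)
    then show ?thesis by (simp add: c t_def power_mult)
  qed
  ultimately show ?thesis by simp
qed

end

theory Submission
  imports Defs
begin

text \<open>
  In the power series of \<open>\<lambda>\<^sub>\<nu>\<close> the inequalities \<open>2 n + 1 \<le> 3 ^ n\<close> and
  \<open>(\<nu> + 1) ^ n \<le> pochhammer (\<nu> + 1) n\<close> give \<open>\<lambda>\<^sub>\<nu> x \<le> exp (3 x\<^sup>2 / (4 (\<nu> + 1)))\<close>, which with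
  \<open>2 u \<le> ln ((1 + u) / (1 - u))\<close>, \<open>u = x\<^sup>2 / r\<^sup>2\<close>, yields the upper bound without the product formula.
  The constant is optimal because \<open>\<lambda>\<^sub>\<nu> x \<ge> 1 + 3 x\<^sup>2 / (4 (\<nu> + 1))\<close>, while the right-hand side has
  slope \<open>2 \<beta>\<close> in \<open>u\<close> at \<open>u = 0\<close>.  A positive \<open>\<alpha>\<close> is impossible because the left-hand side is
  then unbounded on \<open>\<bar>x\<bar> < r\<close>.
\<close>

lemma power_le_pochhammer:
  fixes a :: real
  assumes "a > 0"
  shows "a ^ n \<le> pochhammer a n"
proof (induction n)
  case (Suc n)
  have "a ^ n * a \<le> pochhammer a n * (a + real n)"
    using assms Suc by (intro mult_mono) (auto intro!: pochhammer_nonneg)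
  then show ?case by (simp add: pochhammer_Suc mult.commute)
qed simp

text \<open>For \<nu> > -1 every term of the even power series is nonnegative, so its first two
  terms bound the sum from below.\<close>

lemma modified_dini_normalized_ge:
  assumes "\<nu> > -1"
  shows "1 + 3 * x\<^sup>2 / (4 * (\<nu> + 1)) \<le> modified_dini_normalized \<nu> x"
proof -
  define f where "f = (\<lambda>n. (2 * real n + 1) / (fact n * pochhammer (\<nu> + 1) n) * (x / 2) ^ (2 * n))"
  have S: "f sums modified_dini_normalized \<nu> x"
    unfolding f_def by (rule modified_dini_normalized_sums[OF assms])
  have "f n \<ge> 0" for n
    using assms by (auto simp: f_def power_mult intro!: mult_nonneg_nonneg divide_nonneg_nonneg pochhammer_nonneg)
  then have "sum f {..<2} \<le> suminf f"
    by (intro sum_le_suminf sums_summable[OF S]) auto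
  moreover have "sum f {..<2} = 1 + 3 * x\<^sup>2 / (4 * (\<nu> + 1))"
    by (simp add: f_def numeral_2_eq_2 power2_eq_square)
  ultimately show ?thesis using sums_unique[OF S] by simp
qed

text \<open>Termwise comparison with the exponential series. The terms for n = 0 and n = 1 agree
  exactly, so the coefficient of \<open>x\<^sup>2\<close> is the same as in the lower bound and
  nothing is lost in the constant.\<close>

lemma modified_dini_normalized_le_exp:
  assumes "\<nu> > -1"
  shows "modified_dini_normalized \<nu> x \<le> exp (3 * x\<^sup>2 / (4 * (\<nu> + 1)))"
proof (rule sums_le[OF _ modified_dini_normalized_sums[OF assms]])
  define y where "y = 3 * x\<^sup>2 / (4 * (\<nu> + 1))"
  show "(\<lambda>n. inverse (fact n) * (3 * x\<^sup>2 / (4 * (\<nu> + 1))) ^ n) sums exp (3 * x\<^sup>2 / (4 * (\<nu> + 1)))"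
    using exp_converges[of y] by (simp add: y_def)
  fix n :: nat
  have odd_le: "2 * real n + 1 \<le> 3 ^ n"
    using Bernoulli_inequality[of "2 :: real" n] by (simp add: mult.commute)
  have "(2 * real n + 1) / (fact n * pochhammer (\<nu> + 1) n) \<le> 3 ^ n / (fact n * (\<nu> + 1) ^ n)"
    using assms odd_le power_le_pochhammer[of "\<nu> + 1" n]
    by (intro frac_le mult_left_mono) auto
  then have "(2 * real n + 1) / (fact n * pochhammer (\<nu> + 1) n) * (x / 2) ^ (2 * n)
      \<le> 3 ^ n / (fact n * (\<nu> + 1) ^ n) * (x / 2) ^ (2 * n)"
    by (rule mult_right_mono) (simp add: power_mult)
  also have "\<dots> = 3 ^ n / (fact n * (\<nu> + 1) ^ n) * ((x\<^sup>2) ^ n / 4 ^ n)"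
    by (simp add: power_mult power_divide)
  also have "\<dots> = inverse (fact n) * (3 * x\<^sup>2 / (4 * (\<nu> + 1))) ^ n"
    by (simp only: power_divide power_mult_distrib) (simp add: divide_inverse)
  finally show "(2 * real n + 1) / (fact n * pochhammer (\<nu> + 1) n) * (x / 2) ^ (2 * n)
      \<le> inverse (fact n) * (3 * x\<^sup>2 / (4 * (\<nu> + 1))) ^ n" .
qed

text \<open>The difference of the two sides vanishes at 0 and has derivative 2 t^2 / (1 - t^2),
  which is nonnegative on [0, 1). The factor 2 is the slope of the right side at 0.\<close>

lemma two_mult_le_ln_quotient:
  fixes u :: real
  assumes "0 \<le> u" "u < 1"
  shows "2 * u \<le> ln ((1 + u) / (1 - u))"
proof -
  define f where "f = (\<lambda>u :: real. ln (1 + u) - ln (1 - u) - 2 * u)"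
  have "f 0 \<le> f u"
  proof (rule DERIV_nonneg_imp_nondecreasing[OF assms(1)])
    fix t :: real
    assume t: "0 \<le> t" "t \<le> u"
    then have t1: "t < 1" using assms by simp
    have "(f has_real_derivative (1 / (1 + t) + 1 / (1 - t) - 2)) (at t)"
      unfolding f_def using t t1 by (auto intro!: derivative_eq_intros)
    moreover have "1 / (1 + t) + 1 / (1 - t) - 2 = 2 * t\<^sup>2 / ((1 + t) * (1 - t))"
      using t t1 by (simp add: divide_simps) (simp add: algebra_simps power2_eq_square)
    ultimately show "\<exists>D. (f has_real_derivative D) (at t) \<and> 0 \<le> D"
      using t t1 by (intro exI[of _ "1 / (1 + t) + 1 / (1 - t) - 2"]) simp
  qed
  then show ?thesis using assms by (simp add: f_def ln_div)
qed

text \<open>Both sides equal 1 at u = 0, so an inequality to the right of 0 compares their slopes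
  there, c and 2 \<beta>. If c were larger, \<open>h\<close> would be negative just to the right of
  0.\<close>

lemma redheffer_quotient_slope:
  fixes c \<beta> :: real
  assumes "\<And>u. 0 < u \<Longrightarrow> u < 1 \<Longrightarrow> 1 + c * u \<le> ((1 + u) / (1 - u)) powr \<beta>"
  shows "c \<le> 2 * \<beta>"
proof (rule ccontr)
  define h where "h = (\<lambda>u :: real. ((1 + u) / (1 - u)) powr \<beta> - (1 + c * u))"
  assume "\<not> c \<le> 2 * \<beta>"
  moreover have "(h has_real_derivative (2 * \<beta> - c)) (at 0)"
    unfolding h_def by (auto intro!: derivative_eq_intros)
  ultimately obtain d where d: "d > 0" "\<And>u. 0 < u \<Longrightarrow> u < d \<Longrightarrow> h (0 + u) < h 0"
    using DERIV_neg_dec_right[of h "2 * \<beta> - c" 0] by auto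
  define u where "u = min d 1 / 2"
  have "0 < u" "u < d" "u < 1" using d by (auto simp: u_def)
  with d(2)[of u] assms[of u] show False by (simp add: h_def)
qed

theorem theorem9:
  fixes r \<nu> \<alpha> \<beta> :: real
  assumes "r > 0" and "\<nu> > -1"
  shows "(\<forall>x::real. \<bar>x\<bar> < r \<longrightarrow>
            ((r\<^sup>2 + x\<^sup>2) / (r\<^sup>2 - x\<^sup>2)) powr \<alpha> \<le> modified_dini_normalized \<nu> x \<and>
            modified_dini_normalized \<nu> x \<le> ((r\<^sup>2 + x\<^sup>2) / (r\<^sup>2 - x\<^sup>2)) powr \<beta>)
         \<longleftrightarrow> \<alpha> \<le> 0 \<and> \<beta> \<ge> 3 * r\<^sup>2 / (8 * (\<nu> + 1))"
proof
  assume H: "\<forall>x::real. \<bar>x\<bar> < r \<longrightarrow>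
            ((r\<^sup>2 + x\<^sup>2) / (r\<^sup>2 - x\<^sup>2)) powr \<alpha> \<le> modified_dini_normalized \<nu> x \<and>
            modified_dini_normalized \<nu> x \<le> ((r\<^sup>2 + x\<^sup>2) / (r\<^sup>2 - x\<^sup>2)) powr \<beta>"
  \<comment> \<open>The substitution x = r sqrt u removes r from the quotient and reduces both
    necessity claims to the variable u in [0, 1).\<close>
  have bounds: "((1 + u) / (1 - u)) powr \<alpha> \<le> modified_dini_normalized \<nu> (r * sqrt u) \<and>
      modified_dini_normalized \<nu> (r * sqrt u) \<le> ((1 + u) / (1 - u)) powr \<beta>"
    if u: "0 \<le> u" "u < 1" for u
  proof -
    have "\<bar>r * sqrt u\<bar> < r" using u assms by (simp add: abs_mult)
    moreover have "(r\<^sup>2 + (r * sqrt u)\<^sup>2) / (r\<^sup>2 - (r * sqrt u)\<^sup>2) = (r\<^sup>2 * (1 + u)) / (r\<^sup>2 * (1 - u))"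
      using u by (simp add: power_mult_distrib algebra_simps)
    then have "(r\<^sup>2 + (r * sqrt u)\<^sup>2) / (r\<^sup>2 - (r * sqrt u)\<^sup>2) = (1 + u) / (1 - u)"
      using assms by simp
    ultimately show ?thesis using H by metis
  qed
  have "\<alpha> \<le> 0"
  proof (rule ccontr)
    assume "\<not> \<alpha> \<le> 0"
    then have \<alpha>: "\<alpha> > 0" by simp
    \<comment> \<open>\<open>M\<close> bounds the normalized Dini function on all of \<bar>x\<bar> <
      r. \<open>K\<close> is chosen so that \<open>K powr \<alpha>\<close> is M + 1, and
      \<open>u\<close> is the preimage of \<open>K\<close> under u -> (1 + u) / (1 - u); it lies in
      [0, 1) because K > 1.\<close>
    define M where "M = exp (3 * r\<^sup>2 / (4 * (\<nu> + 1)))"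
    define K where "K = (M + 1) powr (1 / \<alpha>)"
    define u where "u = (K - 1) / (K + 1)"
    have "M > 0" by (simp add: M_def)
    then have K: "K > 1" using \<alpha> by (simp add: K_def)
    then have u: "0 \<le> u" "u < 1" by (auto simp: u_def)
    have "(1 + u) / (1 - u) = K" using K by (simp add: u_def field_simps)
    then have "((1 + u) / (1 - u)) powr \<alpha> = M + 1"
      using \<alpha> \<open>M > 0\<close> by (simp add: K_def powr_powr)
    moreover have "modified_dini_normalized \<nu> (r * sqrt u) \<le> M"
    proof -
      have "(r * sqrt u)\<^sup>2 \<le> r\<^sup>2" using u assms by (simp add: power_mult_distrib)
      then have "exp (3 * (r * sqrt u)\<^sup>2 / (4 * (\<nu> + 1))) \<le> M"
        using assms by (simp add: M_def divide_right_mono)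
      then show ?thesis using modified_dini_normalized_le_exp[OF assms(2), of "r * sqrt u"] by linarith
    qed
    ultimately show False using bounds[OF u] by linarith
  qed
  \<comment> \<open>At x = r sqrt u the two-term lower bound is affine in u, with this left-hand
    side as its slope.\<close>
  moreover have "3 * r\<^sup>2 / (4 * (\<nu> + 1)) \<le> 2 * \<beta>"
  proof (rule redheffer_quotient_slope)
    fix u :: real
    assume u: "0 < u" "u < 1"
    then have "3 * (r * sqrt u)\<^sup>2 / (4 * (\<nu> + 1)) = 3 * r\<^sup>2 / (4 * (\<nu> + 1)) * u"
      by (simp add: power_mult_distrib)
    then show "1 + 3 * r\<^sup>2 / (4 * (\<nu> + 1)) * u \<le> ((1 + u) / (1 - u)) powr \<beta>"
      using bounds[of u] modified_dini_normalized_ge[OF assms(2), of "r * sqrt u"] u by linarith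
  qed
  ultimately show "\<alpha> \<le> 0 \<and> \<beta> \<ge> 3 * r\<^sup>2 / (8 * (\<nu> + 1))"
    using assms by (simp add: field_simps)
next
  assume R: "\<alpha> \<le> 0 \<and> \<beta> \<ge> 3 * r\<^sup>2 / (8 * (\<nu> + 1))"
  show "\<forall>x::real. \<bar>x\<bar> < r \<longrightarrow>
            ((r\<^sup>2 + x\<^sup>2) / (r\<^sup>2 - x\<^sup>2)) powr \<alpha> \<le> modified_dini_normalized \<nu> x \<and>
            modified_dini_normalized \<nu> x \<le> ((r\<^sup>2 + x\<^sup>2) / (r\<^sup>2 - x\<^sup>2)) powr \<beta>"
  proof (intro allI impI)
    fix x :: real
    assume x: "\<bar>x\<bar> < r"
    define u where "u = x\<^sup>2 / r\<^sup>2"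
    have "x\<^sup>2 < r\<^sup>2" using x by (metis abs_ge_zero power2_abs power_strict_mono zero_less_numeral)
    then have u: "0 \<le> u" "u < 1" using assms by (auto simp: u_def)
    have q: "(r\<^sup>2 + x\<^sup>2) / (r\<^sup>2 - x\<^sup>2) = (1 + u) / (1 - u)"
    proof -
      have "x\<^sup>2 = r\<^sup>2 * u" using assms by (simp add: u_def)
      then have "(r\<^sup>2 + x\<^sup>2) / (r\<^sup>2 - x\<^sup>2) = (r\<^sup>2 * (1 + u)) / (r\<^sup>2 * (1 - u))"
        by (simp add: algebra_simps)
      then show ?thesis using assms by simp
    qed
    have q1: "(1 + u) / (1 - u) \<ge> 1" using u by simp
    have ln: "2 * u \<le> ln ((1 + u) / (1 - u))" by (rule two_mult_le_ln_quotient[OF u])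
    have \<beta>0: "\<beta> \<ge> 0"
    proof -
      have "0 \<le> 3 * r\<^sup>2 / (8 * (\<nu> + 1))" using assms by simp
      then show ?thesis using R by linarith
    qed
    \<comment> \<open>The value 1 separates the two sides: a base of at least 1 with exponent
      \<alpha> \<le> 0 stays below it, and the series stays above it.\<close>
    have "((1 + u) / (1 - u)) powr \<alpha> \<le> ((1 + u) / (1 - u)) powr 0"
      using R q1 by (intro powr_mono) auto
    also have "\<dots> = 1" using u by simp
    also have "1 \<le> 1 + 3 * x\<^sup>2 / (4 * (\<nu> + 1))" using assms by simp
    also have "\<dots> \<le> modified_dini_normalized \<nu> x" by (rule modified_dini_normalized_ge[OF assms(2)])
    finally have lower: "((1 + u) / (1 - u)) powr \<alpha> \<le> modified_dini_normalized \<nu> x" .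
    \<comment> \<open>The exponent of the upper bound factors into the critical value of \<beta>
      times 2 u. Each factor is then enlarged separately, and exponentiating turns the result into
      the power with exponent \<beta>.\<close>
    have "3 * x\<^sup>2 / (4 * (\<nu> + 1)) = 3 * r\<^sup>2 / (8 * (\<nu> + 1)) * (2 * u)"
      using assms by (simp add: u_def field_simps)
    also have "\<dots> \<le> \<beta> * ln ((1 + u) / (1 - u))"
      using R ln u \<beta>0 by (intro mult_mono) auto
    finally have "exp (3 * x\<^sup>2 / (4 * (\<nu> + 1))) \<le> ((1 + u) / (1 - u)) powr \<beta>"
      using u by (simp add: powr_def)
    then have "modified_dini_normalized \<nu> x \<le> ((1 + u) / (1 - u)) powr \<beta>"
      using modified_dini_normalized_le_exp[OF assms(2), of x] by linarith
    then show "((r\<^sup>2 + x\<^sup>2) / (r\<^sup>2 - x\<^sup>2)) powr \<alpha> \<le> modified_dini_normalized \<nu> x \<and>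
        modified_dini_normalized \<nu> x \<le> ((r\<^sup>2 + x\<^sup>2) / (r\<^sup>2 - x\<^sup>2)) powr \<beta>"
      using lower by (simp only: q)
  qed
qed

end
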